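(* Let $n\ge2$, $c_0,\dots,c_{n-1}\in\mathbb{R}$, and $f(\lambda)=\lambda_1\cdots\lambda_n-\sum_{k=0}^{n-1}c_k\sigma_k(\lambda)$ on $\mathbb{R}^n$. If a connected component $L$ of $\{f=0\}$ is contained in $q+\Gamma_n$ for some $q\in\mathbb{R}^n$, then $L$ is the unique connected component of $\{f=0\}$ contained in a translate of $\Gamma_n$, and there exists a unique connected component of $\{f>0\}$ which is strictly $\Upsilon$-stable and whose boundary is $L$.
   Context: $\sigma_k(\lambda)$ is the $k$-th elementary symmetric polynomial of $\lambda_1,\dots,\lambda_n$ ($\sigma_0=1$); $\Gamma_n=\{\lambda\in\mathbb{R}^n:\lambda_i>0\ \forall i\}$. A connected component $\Gamma_f^n$ of $\{f>0\}$ is $\Upsilon$-stable if $\Gamma_f^n\subseteq q+\Gamma_n$ for some $q\in\mathbb{R}^n$. Let $\Gamma_f^{n-1}$ be the projection of $\Gamma_f^n$ to $\mathbb{R}^{n-1}$ dropping the last coordinate and $\Upsilon_1=\{\mu\in\mathbb{R}^n:(\mu_{s(1)},\dots,\mu_{s(n-1)})\in\Gamma_f^{n-1}\ \forall s\in S_n\}$. $\Gamma_f^n$ is strictly $\Upsilon$-stable if it is $\Upsilon$-stable and $\partial\Gamma_f^n\subseteq\Upsilon_1$. *)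

theory Defs
  imports "HOL-Analysis.Analysis"
begin

definition esym :: "nat \<Rightarrow> real ^ 'n \<Rightarrow> real" where
  "esym k x = (\<Sum>I | card I = k. \<Prod>i\<in>I. x $ i)"

definition pos_cone :: "(real ^ 'n) set" where
  "pos_cone = {x. \<forall>i. x $ i > 0}"

definition upsilon_poly :: "(nat \<Rightarrow> real) \<Rightarrow> real ^ 'n \<Rightarrow> real" where
  "upsilon_poly c x = (\<Prod>i\<in>UNIV. x $ i) - (\<Sum>k<CARD('n). c k * esym k x)"

definition upsilon_stable :: "(real ^ 'n \<Rightarrow> real) \<Rightarrow> (real ^ 'n) set \<Rightarrow> bool" where
  "upsilon_stable f C \<longleftrightarrow>
     C \<in> components {x. f x > 0} \<and> (\<exists>q. C \<subseteq> (+) q ` pos_cone)"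

text \<open>The coordinates are ordered by a linear order on the finite index type; the last one is
  \<open>Max UNIV\<close>. A point of the space with one dimension less is represented by an extensional function
  on the remaining indices.\<close>

definition drop_last :: "real ^ 'n::{finite,linorder} \<Rightarrow> 'n \<Rightarrow> real" where
  "drop_last x = (\<lambda>i\<in>UNIV - {Max UNIV}. x $ i)"

definition upsilon_1 :: "(real ^ 'n::{finite,linorder}) set \<Rightarrow> (real ^ 'n::{finite,linorder}) set" where
  "upsilon_1 C = {\<mu>. \<forall>s. s permutes UNIV \<longrightarrow> drop_last (\<chi> i. \<mu> $ s i) \<in> drop_last ` C}"

definition strictly_upsilon_stable ::
    "(real ^ 'n::{finite,linorder} \<Rightarrow> real) \<Rightarrow> (real ^ 'n::{finite,linorder}) set \<Rightarrow> bool" where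
  "strictly_upsilon_stable f C \<longleftrightarrow> upsilon_stable f C \<and> frontier C \<subseteq> upsilon_1 C"

end

theory Submission
  imports Defs
begin

text \<open>
  The polynomial \<open>f\<close> is affine in each coordinate separately. Restricted to a plane spanned by two
  coordinate directions through a point \<open>p\<close> of \<open>L\<close>, it is therefore \<open>s a + t b + s t A\<close>, where \<open>a\<close>, \<open>b\<close>
  are the partial derivatives at \<open>p\<close> and \<open>A\<close> is the mixed second one, and the zero set of this restriction is a
  hyperbola, a cross, a line or the whole plane. The part of it that is connected to \<open>p\<close> lies in \<open>L\<close>, so it is bounded
  below in both coordinates; only the upper right branch of a hyperbola is. Hence \<open>a\<close>, \<open>b\<close>, \<open>A\<close> are
  nonzero and have the same sign (lemmas \<open>slope_nonzero\<close>, \<open>slope_mixed_same_sign\<close>), and one coordinate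
  of a point of \<open>L\<close> can be increased at will if another one is decreased along the branch (\<open>slide_up\<close>).

  Fix a coordinate \<open>j\<close>. The column over \<open>L\<close>, the union of all lines in direction \<open>j\<close> that meet \<open>L\<close>, is then
  closed under increasing coordinates. The \<open>j\<close>-th partial derivative does not vanish on it, and as \<open>f\<close> grows
  like the product of the coordinates, it is positive there (\<open>slope_pos_column\<close>). So each line of the
  column meets the zero set exactly once: \<open>L\<close> is a graph over an open base that is closed under increasing coordinates.

  Everything follows from this picture. Two zero components that are bounded below have columns
  with a common point, hence a common point themselves, hence coincide. The part of the
  column above the graph is open and connected. A sequence in it that converges has bounded heights above
  the graph, because \<open>L\<close> is bounded below, and as \<open>L\<close> is closed, the limit is still in the column
  (\<open>closure_above_subset_column\<close>). Therefore the frontier of the part above the graph is \<open>L\<close>, where \<open>f\<close>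
  vanishes, and this part is a component of \<open>{f > 0}\<close>. It is the only one with frontier \<open>L\<close>, because near \<open>L\<close> every
  point with \<open>f > 0\<close> belongs to it. Finally, a permutation of the coordinates maps \<open>L\<close> to a zero component
  that is bounded below, that is, to \<open>L\<close>; and \<open>L\<close> has the same projection as the region above
  it. This makes the region strictly stable.
\<close>

section \<open>Zero components that are bounded below\<close>

text \<open>
  The shape of \<open>L\<close> is governed by affinity in each coordinate and by growth like the product of the
  coordinates. The lower bound \<open>q\<close> expresses that \<open>L\<close> lies in a translate of the positive cone.
\<close>

locale affine_zero_component =
  fixes f :: "real ^ 'n \<Rightarrow> real" and L :: "(real ^ 'n) set" and q :: "real ^ 'n"
  assumes cont: "continuous_on UNIV f"
    and affine: "f (x + t *\<^sub>R axis i 1) = f x + t * (f (x + axis i 1) - f x)"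
    and growth: "((\<lambda>t. f (x + t *\<^sub>R v) / t ^ CARD('n)) \<longlongrightarrow> (\<Prod>i\<in>UNIV. v $ i)) at_top"
    and comp: "L \<in> components {x. f x = 0}"
    and below: "x \<in> L \<Longrightarrow> q $ i < x $ i"
begin

text \<open>By affinity, this difference quotient is the partial derivative in direction \<open>i\<close>.\<close>

definition slope :: "'n \<Rightarrow> real ^ 'n \<Rightarrow> real" where
  "slope i x = f (x + axis i 1) - f x"

text \<open>Likewise, this is the mixed second partial derivative.\<close>

definition mixed :: "'n \<Rightarrow> 'n \<Rightarrow> real ^ 'n \<Rightarrow> real" where
  "mixed i j x = slope j (x + axis i 1) - slope j x"

lemma affine_slope: "f (x + t *\<^sub>R axis i 1) = f x + t * slope i x"
  using affine[of x t i] by (simp add: slope_def)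

lemma slope_shift_self: "slope i (x + t *\<^sub>R axis i 1) = slope i x"
proof -
  have "x + t *\<^sub>R axis i 1 + axis i 1 = x + (t + 1) *\<^sub>R axis i (1::real)"
    by (simp add: algebra_simps)
  then have "slope i (x + t *\<^sub>R axis i 1) = f (x + (t + 1) *\<^sub>R axis i 1) - f (x + t *\<^sub>R axis i 1)"
    by (simp only: slope_def)
  then show ?thesis
    by (simp only: affine_slope) (simp add: algebra_simps)
qed

lemma slope_affine: "slope j (x + s *\<^sub>R axis i 1) = slope j x + s * mixed i j x"
proof -
  have "x + s *\<^sub>R axis i 1 + axis j 1 = (x + axis j 1) + s *\<^sub>R axis i (1::real)"
    by simp
  then have "slope j (x + s *\<^sub>R axis i 1)
      = f (x + axis j 1) + s * slope i (x + axis j 1) - (f x + s * slope i x)"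
    unfolding slope_def[of j] by (simp only: affine_slope)
  moreover have "slope i (x + axis j 1) - slope i x = mixed i j x"
    by (simp add: mixed_def slope_def add_ac)
  ultimately show ?thesis
    by (simp add: slope_def[of j x] algebra_simps flip: \<open>_ = mixed i j x\<close>)
qed

lemma slice:
  "f (x + s *\<^sub>R axis i 1 + t *\<^sub>R axis j 1)
    = f x + s * slope i x + t * (slope j x + s * mixed i j x)"
  by (simp add: affine_slope slope_affine)

lemma continuous_on_f: "continuous_on A f"
  using cont continuous_on_subset by blast

lemma continuous_slope: "continuous_on A (slope i)"
  unfolding slope_def
  by (intro continuous_intros continuous_on_compose2[OF cont]) auto

lemma zero_on_L: "p \<in> L \<Longrightarrow> f p = 0"
  using in_components_subset[OF comp] by auto

lemma closed_L: "closed L"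
proof -
  have "closed {x. f x = 0}"
    using continuous_closed_vimage[of "{0}" f] cont
    by (simp add: vimage_def continuous_on_eq_continuous_at)
  then show ?thesis
    using closed_components comp by blast
qed

lemma connected_subset_L:
  "\<lbrakk>connected T; p \<in> T; p \<in> L; \<And>x. x \<in> T \<Longrightarrow> f x = 0\<rbrakk> \<Longrightarrow> T \<subseteq> L"
  using components_maximal[OF comp, of T] by blast

text \<open>If the slope vanished, the whole line in direction \<open>j\<close> would be contained in \<open>L\<close>, which is bounded below.\<close>

lemma slope_nonzero:
  assumes "p \<in> L"
  shows "slope j p \<noteq> 0"
proof
  assume 0: "slope j p = 0"
  let ?T = "range (\<lambda>t. p + t *\<^sub>R axis j (1::real))"
  have "?T \<subseteq> L"
  proof (rule connected_subset_L)
    show "connected ?T"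
      by (intro connected_continuous_image continuous_intros connected_UNIV)
    show "p \<in> ?T"
      by (rule image_eqI[of _ _ 0]) auto
    show "f x = 0" if "x \<in> ?T" for x
      using that 0 zero_on_L[OF assms] by (auto simp: affine_slope)
  qed (fact assms)
  then have "p + (q $ j - p $ j) *\<^sub>R axis j 1 \<in> L"
    by blast
  from below[OF this, of j] show False
    by simp
qed

text \<open>On the slice through \<open>p\<close>, with slopes \<open>a\<close>, \<open>b\<close> in directions \<open>i\<close>, \<open>j\<close> and mixed derivative \<open>A\<close>, solving
  \<open>s a + t b + s t A = 0\<close> for \<open>t\<close> moves \<open>p\<close> along its hyperbola. The path stays in the component as long
  as the denominator \<open>b + s A\<close> does not vanish.\<close>

lemma slide_along_slice:
  assumes p: "p \<in> L" and T: "connected T" "0 \<in> T"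
    and nz: "\<And>s. s \<in> T \<Longrightarrow> slope j p + s * mixed i j p \<noteq> 0"
    and s: "s \<in> T"
  shows "p + s *\<^sub>R axis i 1 + (- s * slope i p / (slope j p + s * mixed i j p)) *\<^sub>R axis j 1 \<in> L"
proof -
  let ?g = "\<lambda>s. p + s *\<^sub>R axis i 1
    + (- s * slope i p / (slope j p + s * mixed i j p)) *\<^sub>R axis j 1"
  have "?g ` T \<subseteq> L"
  proof (rule connected_subset_L)
    show "connected (?g ` T)"
      by (intro connected_continuous_image continuous_intros T) (use nz in auto)
    show "p \<in> ?g ` T"
      by (rule image_eqI[of _ _ 0]) (use T in auto)
    show "f x = 0" if "x \<in> ?g ` T" for x
    proof -
      obtain r where r: "r \<in> T" "x = ?g r"
        using \<open>x \<in> ?g ` T\<close> by (rule imageE)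
      show ?thesis
        unfolding r(2) slice using nz[OF r(1)] zero_on_L[OF p] by simp
    qed
  qed (fact p)
  then show ?thesis
    using s by blast
qed

text \<open>Otherwise the denominator \<open>b + s A\<close> would have no zero for \<open>s \<le> 0\<close>, and \<open>p\<close> could slide along its hyperbola
  to arbitrarily small values of the coordinate \<open>i\<close>.\<close>

lemma slope_mixed_same_sign:
  assumes p: "p \<in> L" and ij: "i \<noteq> j"
  shows "slope j p * mixed i j p > 0"
proof (rule ccontr)
  assume neg: "\<not> ?thesis"
  \<comment> \<open>Sliding by this amount makes the coordinate \<open>i\<close> equal to its strict lower bound \<open>q $ i\<close>.\<close>
  let ?s = "q $ i - p $ i"
  have nz: "slope j p + s * mixed i j p \<noteq> 0" if "s \<in> {..0}" for s
  proof
    assume 0: "slope j p + s * mixed i j p = 0"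
    have "slope j p * slope j p + s * (slope j p * mixed i j p)
        = slope j p * (slope j p + s * mixed i j p)"
      by (simp add: algebra_simps)
    moreover have "slope j p * slope j p > 0"
      using slope_nonzero[OF p, of j] by (auto simp: zero_less_mult_iff linorder_neq_iff)
    moreover have "s * (slope j p * mixed i j p) \<ge> 0"
      using that neg by (intro mult_nonpos_nonpos) auto
    ultimately show False
      by (simp add: 0)
  qed
  have "?s \<in> {..0}"
    using below[OF p, of i] by simp
  from below[OF slide_along_slice[OF p _ _ nz this], of i] ij show False
    by (auto simp: axis_def)
qed

lemma slide_up:
  assumes p: "p \<in> L" and ij: "i \<noteq> j" and s: "s \<ge> 0"
  shows "\<exists>t. p + s *\<^sub>R axis i 1 + t *\<^sub>R axis j 1 \<in> L"
proof -
  have nz: "slope j p + s * mixed i j p \<noteq> 0" if "s \<in> {0..}" for s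
    using slope_mixed_same_sign[OF p ij] that
    by (smt (verit) atLeast_iff mult_nonneg_nonneg mult_nonneg_nonpos zero_less_mult_iff)
  show ?thesis
    using slide_along_slice[OF p _ _ nz, where s = s and T = "{0..}"] s by fastforce
qed


section \<open>The column over a zero component\<close>

definition column :: "'n \<Rightarrow> (real ^ 'n) set" where
  "column j = {x. \<exists>t. x + t *\<^sub>R axis j 1 \<in> L}"

lemma columnI: "x + t *\<^sub>R axis j 1 \<in> L \<Longrightarrow> x \<in> column j"
  unfolding column_def by blast

lemma L_subset_column: "L \<subseteq> column j"
  unfolding column_def by (auto intro: exI[of _ 0])

lemma column_add_axis:
  assumes x: "x \<in> column j" and s: "s \<ge> 0"
  shows "x + s *\<^sub>R axis i 1 \<in> column j"
proof -
  obtain t where t: "x + t *\<^sub>R axis j 1 \<in> L"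
    using x by (auto simp: column_def)
  show ?thesis
  proof (cases "i = j")
    case True
    have "x + s *\<^sub>R axis i 1 + (t - s) *\<^sub>R axis j 1 = x + t *\<^sub>R axis j (1::real)"
      using True by (simp add: algebra_simps)
    with t have "x + s *\<^sub>R axis i 1 + (t - s) *\<^sub>R axis j 1 \<in> L"
      by (simp only:)
    then show ?thesis
      by (rule columnI)
  next
    case False
    then obtain r where "x + t *\<^sub>R axis j 1 + s *\<^sub>R axis i 1 + r *\<^sub>R axis j 1 \<in> L"
      using slide_up[OF t _ s] by blast
    moreover have "x + t *\<^sub>R axis j 1 + s *\<^sub>R axis i 1 + r *\<^sub>R axis j 1
        = x + s *\<^sub>R axis i 1 + (t + r) *\<^sub>R axis j (1::real)"
      by (simp add: algebra_simps)
    ultimately have "x + s *\<^sub>R axis i 1 + (t + r) *\<^sub>R axis j 1 \<in> L"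
      by (simp only:)
    then show ?thesis
      by (rule columnI)
  qed
qed

text \<open>The coordinates are raised one at a time; \<open>slide_up\<close> pays for each of them in direction \<open>j\<close>, which the
  column does not see.\<close>

lemma column_upward_closed:
  assumes x: "x \<in> column j" and le: "\<And>i. x $ i \<le> y $ i"
  shows "y \<in> column j"
proof -
  have "x + (\<Sum>i\<in>F. (y $ i - x $ i) *\<^sub>R axis i 1) \<in> column j" for F
    using finite[of F]
  proof (induction F)
    case (insert i F)
    then show ?case
      using column_add_axis[OF insert.IH, of "y $ i - x $ i" i] le by (simp add: add_ac)
  qed (simp add: x)
  moreover have "(\<Sum>i\<in>UNIV. (y $ i - x $ i) *\<^sub>R axis i 1) = y - x"
    using basis_expansion[of "y - x"] by (simp add: scalar_mult_eq_scaleR)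
  ultimately have "x + (y - x) \<in> column j"
    by metis
  then show ?thesis
    by simp
qed

lemma slope_nonzero_column:
  assumes "x \<in> column j"
  shows "slope j x \<noteq> 0"
proof -
  obtain t where "x + t *\<^sub>R axis j 1 \<in> L"
    using assms by (auto simp: column_def)
  from slope_nonzero[OF this, of j] show ?thesis
    by (simp add: slope_shift_self)
qed

text \<open>Far out on the diagonal the polynomial behaves like the product of the coordinates. Comparing the growth rates in the
  directions \<open>1 + axis j 1\<close> and \<open>1\<close>, which are \<open>2\<close> and \<open>1\<close>, gives the sign of the slope there.\<close>

lemma slope_eventually_pos: "\<forall>\<^sub>F t in at_top. slope j (x + t *\<^sub>R 1) > 0"
proof -
  let ?v = "1 + axis j 1 :: real ^ 'n"
  have "(\<Prod>i\<in>UNIV. ?v $ i) = (\<Prod>i\<in>UNIV. if i = j then 2 else 1)"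
    by (intro prod.cong) (auto simp: axis_def)
  then have v: "(\<Prod>i\<in>UNIV. ?v $ i) = 2"
    by simp
  have "((\<lambda>t. f (x + t *\<^sub>R ?v) / t ^ CARD('n) - f (x + t *\<^sub>R 1) / t ^ CARD('n))
      \<longlongrightarrow> 2 - 1) at_top"
    using tendsto_diff[OF growth[of x ?v] growth[of x 1]] by (simp only: v) simp
  then have "\<forall>\<^sub>F t in at_top. f (x + t *\<^sub>R ?v) / t ^ CARD('n) - f (x + t *\<^sub>R 1) / t ^ CARD('n) > 0"
    by (rule order_tendstoD) simp
  then show ?thesis
    using eventually_gt_at_top[of 0]
  proof eventually_elim
    case (elim t)
    have "f (x + t *\<^sub>R ?v) = f (x + t *\<^sub>R 1) + t * slope j (x + t *\<^sub>R 1)"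
      using affine_slope[of "x + t *\<^sub>R 1" t j] by (simp add: scaleR_add_right add.assoc)
    then have "t * slope j (x + t *\<^sub>R 1) / t ^ CARD('n) > 0"
      using elim by (simp add: diff_divide_distrib[symmetric])
    then show ?case
      using elim by (auto simp: zero_less_divide_iff zero_less_mult_iff)
  qed
qed

text \<open>On the diagonal ray from \<open>x\<close>, which stays in the column, the slope does not vanish, and far out it is
  positive.\<close>

lemma slope_pos_column:
  assumes x: "x \<in> column j"
  shows "slope j x > 0"
proof (rule ccontr)
  assume "\<not> ?thesis"
  then have le: "slope j x \<le> 0"
    by simp
  obtain T where T: "T \<ge> 0" "slope j (x + T *\<^sub>R 1) > 0"
    using eventually_conj[OF slope_eventually_pos[of j x] eventually_ge_at_top[of 0]]
      eventually_happens'[OF trivial_limit_at_top_linorder] by blast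
  have "\<exists>t\<ge>0. t \<le> T \<and> slope j (x + t *\<^sub>R 1) = 0"
    using le T
    by (intro IVT' continuous_on_compose2[OF continuous_slope[of UNIV]] continuous_intros) auto
  then obtain t where "t \<ge> 0" "slope j (x + t *\<^sub>R 1) = 0"
    by blast
  moreover from \<open>t \<ge> 0\<close> have "x + t *\<^sub>R 1 \<in> column j"
    by (intro column_upward_closed[OF x]) simp
  ultimately show False
    using slope_nonzero_column by blast
qed

lemma zero_in_column_in_L:
  assumes x: "x \<in> column j" and 0: "f x = 0"
  shows "x \<in> L"
proof -
  obtain t where t: "x + t *\<^sub>R axis j 1 \<in> L"
    using x by (auto simp: column_def)
  then have "t * slope j x = 0"
    using zero_on_L[OF t] 0 by (simp add: affine_slope)
  then show ?thesis
    using t slope_nonzero_column[OF x] by simp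
qed

text \<open>The map \<open>g\<close> below projects a neighbourhood of \<open>x\<close> to the zero set along direction \<open>j\<close>. Its image is connected
  and meets \<open>L\<close>, so it is contained in \<open>L\<close>.\<close>

lemma open_column: "open (column j)"
proof (rule openI)
  fix x
  assume x: "x \<in> column j"
  let ?g = "\<lambda>y. y + (- f y / slope j y) *\<^sub>R axis j 1"
  have "open {y. slope j y > 0}"
    using continuous_slope[of UNIV j]
    by (intro open_Collect_less continuous_intros) auto
  then obtain e where e: "e > 0" "ball x e \<subseteq> {y. slope j y > 0}"
    using slope_pos_column[OF x] openE[of "{y. slope j y > 0}" x] by auto
  have nz: "slope j y \<noteq> 0" if "y \<in> ball x e" for y
    using e that by fastforce
  have gL: "?g x \<in> L"
  proof (rule zero_in_column_in_L)
    show "f (?g x) = 0"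
      using slope_nonzero_column[OF x] by (simp only: affine_slope) simp
    obtain t where "x + t *\<^sub>R axis j 1 \<in> L"
      using x by (auto simp: column_def)
    moreover have "?g x + (t + f x / slope j x) *\<^sub>R axis j 1 = x + t *\<^sub>R axis j (1::real)"
      by (simp add: algebra_simps)
    ultimately have "?g x + (t + f x / slope j x) *\<^sub>R axis j 1 \<in> L"
      by (simp only:)
    then show "?g x \<in> column j"
      by (rule columnI)
  qed
  have "?g ` ball x e \<subseteq> L"
  proof (rule connected_subset_L[OF _ _ gL])
    show "connected (?g ` ball x e)"
      by (intro connected_continuous_image continuous_intros continuous_on_f continuous_slope)
        (use nz in auto)
    show "?g x \<in> ?g ` ball x e"
      using e by simp
    show "f z = 0" if "z \<in> ?g ` ball x e" for z
    proof -
      obtain y where y: "y \<in> ball x e" "z = ?g y"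
        using \<open>z \<in> ?g ` ball x e\<close> by (rule imageE)
      show ?thesis
        unfolding y(2) affine_slope using nz[OF y(1)] by simp
    qed
  qed
  then show "\<exists>e>0. ball x e \<subseteq> column j"
    using e(1) columnI by blast
qed


section \<open>The region above a zero component\<close>

definition above :: "'n \<Rightarrow> (real ^ 'n) set" where
  "above j = {x \<in> column j. f x > 0}"

lemma above_eq: "above j = (\<lambda>(p, t). p + t *\<^sub>R axis j 1) ` (L \<times> {0<..})"
proof (intro equalityI subsetI)
  fix x
  assume x: "x \<in> above j"
  then obtain t where t: "x + t *\<^sub>R axis j 1 \<in> L"
    by (auto simp: above_def column_def)
  have "f x + t * slope j x = 0"
    using zero_on_L[OF t] by (simp add: affine_slope)
  moreover have "slope j x > 0" "f x > 0"
    using x slope_pos_column by (auto simp: above_def)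
  ultimately have "t < 0"
    by (smt (verit) mult_nonneg_nonneg)
  then show "x \<in> (\<lambda>(p, t). p + t *\<^sub>R axis j 1) ` (L \<times> {0<..})"
    using t by (intro image_eqI[of _ _ "(x + t *\<^sub>R axis j 1, - t)"]) auto
next
  fix x
  assume "x \<in> (\<lambda>(p, t). p + t *\<^sub>R axis j 1) ` (L \<times> {0<..})"
  then obtain p t where pt: "p \<in> L" "t > 0" "x = p + t *\<^sub>R axis j 1"
    by auto
  then have pc: "p \<in> column j"
    using L_subset_column by blast
  then show "x \<in> above j"
    using pt slope_pos_column[OF pc] zero_on_L column_add_axis[OF pc]
    by (simp add: above_def affine_slope)
qed

lemma open_above: "open (above j)"
proof -
  have "open {x. f x > 0}"
    using cont by (intro open_Collect_less continuous_intros) auto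
  then have "open (column j \<inter> {x. f x > 0})"
    using open_column by blast
  moreover have "column j \<inter> {x. f x > 0} = above j"
    by (auto simp: above_def)
  ultimately show ?thesis
    by simp
qed

lemma connected_above: "connected (above j)"
  unfolding above_eq
  by (intro connected_continuous_image connected_Times in_components_connected[OF comp])
    (auto simp: case_prod_unfold intro!: continuous_intros)

text \<open>Near \<open>x\<close>, the heights above the graph are bounded because \<open>L\<close> is bounded below. So locally the region is
  contained in the sum of the closed set \<open>L\<close> and a compact segment, which is closed.\<close>

lemma closure_above_subset_column: "closure (above j) \<subseteq> column j"
proof
  fix x
  assume x: "x \<in> closure (above j)"
  \<comment> \<open>A bound for the height of a point at distance less than 1 from \<open>x\<close>.\<close>
  define M where "M = x $ j + 1 - q $ j"
  let ?K = "(\<lambda>t. t *\<^sub>R axis j 1) ` {0..M} :: (real ^ 'n) set"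
  have "compact ?K"
    by (intro compact_continuous_image continuous_intros) auto
  then have clo: "closed (\<Union>p\<in>L. \<Union>k\<in>?K. {p + k})"
    by (rule closed_compact_sums[OF closed_L])
  have "above j \<inter> ball x 1 \<subseteq> (\<Union>p\<in>L. \<Union>k\<in>?K. {p + k})"
  proof
    fix y
    assume y: "y \<in> above j \<inter> ball x 1"
    then obtain p t where pt: "p \<in> L" "t > 0" "y = p + t *\<^sub>R axis j 1"
      by (auto simp: above_eq)
    have "\<bar>x $ j - y $ j\<bar> \<le> dist x y"
      using component_le_norm_cart[of "x - y" j] by (simp add: dist_norm)
    then have "y $ j \<le> x $ j + 1"
      using y by auto
    moreover have "y $ j = p $ j + t"
      by (simp add: pt)
    ultimately have "t \<le> M"
      using below[OF pt(1), of j] by (simp add: M_def)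
    then show "y \<in> (\<Union>p\<in>L. \<Union>k\<in>?K. {p + k})"
      using pt by force
  qed
  moreover have "x \<in> closure (above j \<inter> ball x 1)"
    using x open_Int_closure_subset[of "ball x 1" "above j"]
    by (auto simp: Int_commute)
  ultimately have "x \<in> (\<Union>p\<in>L. \<Union>k\<in>?K. {p + k})"
    using clo closure_minimal by blast
  then obtain p t where "p \<in> L" "x = p + t *\<^sub>R axis j 1"
    by auto
  then have "x + (- t) *\<^sub>R axis j 1 \<in> L"
    by simp
  then show "x \<in> column j"
    by (rule columnI)
qed

lemma frontier_above: "frontier (above j) = L"
proof (intro equalityI subsetI)
  fix x
  assume x: "x \<in> frontier (above j)"
  then have xc: "x \<in> closure (above j)" "x \<notin> above j"
    using open_above by (auto simp: frontier_def interior_open)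
  then have col: "x \<in> column j"
    using closure_above_subset_column by blast
  have "closed {x. f x \<ge> 0}"
    using cont by (intro closed_Collect_le continuous_intros) auto
  moreover have "above j \<subseteq> {x. f x \<ge> 0}"
    by (auto simp: above_def)
  ultimately have "f x \<ge> 0"
    using xc(1) closure_minimal by blast
  with xc(2) col have "f x = 0"
    by (auto simp: above_def)
  then show "x \<in> L"
    using zero_in_column_in_L[OF col] by simp
next
  fix p
  assume p: "p \<in> L"
  have "p \<in> closure (above j)"
    unfolding closure_approachable
  proof (intro allI impI)
    fix e :: real
    assume "e > 0"
    then have "p + (e/2) *\<^sub>R axis j 1 \<in> above j"
      using p unfolding above_eq by force
    moreover have "dist (p + (e/2) *\<^sub>R axis j 1) p < e"
      using \<open>e > 0\<close> by (simp add: dist_norm)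
    ultimately show "\<exists>y\<in>above j. dist y p < e"
      by blast
  qed
  moreover have "p \<notin> above j"
    using zero_on_L[OF p] by (simp add: above_def)
  ultimately show "p \<in> frontier (above j)"
    using open_above by (simp add: frontier_def interior_open)
qed

lemma above_nonempty: "above j \<noteq> {}"
  using in_components_nonempty[OF comp] unfolding above_eq by force

text \<open>A larger connected set would meet the frontier, which is \<open>L\<close>, and there \<open>f\<close> is not positive.\<close>

lemma above_component: "above j \<in> components {x. f x > 0}"
  unfolding in_components_maximal
proof (intro conjI allI impI)
  show "above j \<noteq> {}" "connected (above j)"
    by (rule above_nonempty connected_above)+
  show "above j \<subseteq> {x. f x > 0}"
    by (auto simp: above_def)
  fix T
  assume T: "T \<noteq> {} \<and> above j \<subseteq> T \<and> T \<subseteq> {x. f x > 0} \<and> connected T"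
  show "T = above j"
  proof (rule ccontr)
    assume "T \<noteq> above j"
    then have "T \<inter> frontier (above j) \<noteq> {}"
      using T above_nonempty[of j] connected_Int_frontier[of T "above j"] by blast
    then show False
      using T zero_on_L by (force simp: frontier_above)
  qed
qed

text \<open>The column is an open neighbourhood of \<open>L\<close>, so \<open>C\<close> has points in it, and these are in the region above \<open>L\<close>.\<close>

lemma component_with_frontier_L_unique:
  assumes C: "C \<in> components {x. f x > 0}" and fr: "frontier C = L"
  shows "C = above j"
proof -
  obtain p where p: "p \<in> L"
    using in_components_nonempty[OF comp] by blast
  then have "p \<in> closure C"
    using fr by (auto simp: frontier_def)
  moreover have "p \<in> column j"
    using p L_subset_column by blast
  ultimately obtain x where "x \<in> C" "x \<in> column j"
    using open_column[of j] by (metis closure_iff_nhds_not_empty disjoint_iff order_refl)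
  then have "x \<in> above j"
    using in_components_subset[OF C] by (auto simp: above_def)
  then show ?thesis
    using \<open>x \<in> C\<close> components_nonoverlap[OF C above_component] by blast
qed

text \<open>As columns are closed under increasing coordinates, the maximum of a point of \<open>L\<close> and a point of \<open>L'\<close> is in both columns. The line in
  direction \<open>j\<close> through it meets \<open>L\<close> and \<open>L'\<close>, but contains only one zero of \<open>f\<close>.\<close>

lemma zero_component_unique:
  assumes comp': "L' \<in> components {x. f x = 0}"
    and below': "\<And>x i. x \<in> L' \<Longrightarrow> q' $ i < x $ i"
  shows "L' = L"
proof -
  interpret L': affine_zero_component f L' q'
    using cont affine growth comp' below' by (rule affine_zero_component.intro)
  fix j :: 'n
  obtain p p' where p: "p \<in> L" "p' \<in> L'"
    using in_components_nonempty[OF comp] in_components_nonempty[OF comp'] by blast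
  define m where "m = (\<chi> i. max (p $ i) (p' $ i))"
  have "m \<in> column j"
    by (rule column_upward_closed[of p]) (use p L_subset_column in \<open>auto simp: m_def\<close>)
  moreover have "m \<in> L'.column j"
    by (rule L'.column_upward_closed[of p']) (use p L'.L_subset_column in \<open>auto simp: m_def\<close>)
  ultimately obtain t t' where t: "m + t *\<^sub>R axis j 1 \<in> L" "m + t' *\<^sub>R axis j 1 \<in> L'"
    by (auto simp: column_def L'.column_def)
  then have "f m + t * slope j m = f m + t' * slope j m"
    using zero_on_L[OF t(1)] L'.zero_on_L[OF t(2)] by (simp add: affine_slope)
  then have "t = t'"
    using slope_nonzero_column[OF \<open>m \<in> column j\<close>] by simp
  then show ?thesis
    using t components_nonoverlap[OF comp' comp] by blast
qed

end


section \<open>Affinity, growth and symmetry of the polynomials\<close>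

lemma continuous_upsilon_poly: "continuous_on A (upsilon_poly c)"
  unfolding upsilon_poly_def esym_def by (intro continuous_intros)

text \<open>A monomial without repeated factors contains the coordinate \<open>i\<close> at most once.\<close>

lemma prod_coordinates_affine:
  fixes x :: "real ^ 'n"
  shows "(\<Prod>j\<in>I. (x + t *\<^sub>R axis i 1) $ j)
    = (\<Prod>j\<in>I. x $ j) + t * ((\<Prod>j\<in>I. (x + axis i 1) $ j) - (\<Prod>j\<in>I. x $ j))"
proof (cases "i \<in> I")
  case True
  have "(\<Prod>j\<in>I. (x + r *\<^sub>R axis i 1) $ j) = (x $ i + r) * (\<Prod>j\<in>I - {i}. x $ j)" for r
  proof -
    have "(\<Prod>j\<in>I - {i}. (x + r *\<^sub>R axis i 1) $ j) = (\<Prod>j\<in>I - {i}. x $ j)"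
      by (intro prod.cong) (auto simp: axis_def)
    then show ?thesis
      using prod.remove[of I i "\<lambda>j. (x + r *\<^sub>R axis i 1) $ j"] True by simp
  qed
  from this[of t] this[of 1] this[of 0] show ?thesis
    by (simp add: algebra_simps)
next
  case False
  have "(\<Prod>j\<in>I. (x + r *\<^sub>R axis i 1) $ j) = (\<Prod>j\<in>I. x $ j)" for r
    using False by (intro prod.cong) (auto simp: axis_def)
  from this[of t] this[of 1] show ?thesis
    by simp
qed

lemma upsilon_poly_affine:
  "upsilon_poly c (x + t *\<^sub>R axis i 1)
    = upsilon_poly c x + t * (upsilon_poly c (x + axis i 1) - upsilon_poly c x)"
proof -
  have e: "esym k (x + t *\<^sub>R axis i 1) = esym k x + t * (esym k (x + axis i 1) - esym k x)" for k
    unfolding esym_def prod_coordinates_affine[of x t]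
    by (simp add: sum.distrib sum_subtractf sum_distrib_left right_diff_distrib)
  show ?thesis
    unfolding upsilon_poly_def e prod_coordinates_affine[of x t]
    by (simp add: sum.distrib sum_subtractf sum_distrib_left algebra_simps)
qed

text \<open>Dividing each of the \<open>k\<close> factors of a monomial by \<open>t\<close> leaves a convergent product times \<open>t\<close> to the power
  \<open>- (m - k)\<close>.\<close>

lemma esym_growth_lower:
  fixes x v :: "real ^ 'n"
  assumes k: "k < m"
  shows "((\<lambda>t. esym k (x + t *\<^sub>R v) / t ^ m) \<longlongrightarrow> 0) at_top"
proof -
  have lim: "((\<lambda>t. \<Sum>I | card I = k. (\<Prod>i\<in>I. x $ i / t + v $ i) * (1 / t) ^ (m - k))
      \<longlongrightarrow> (\<Sum>I | card I = k. (\<Prod>i\<in>I. 0 + v $ i) * 0 ^ (m - k))) at_top"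
    by (intro tendsto_intros tendsto_divide_0[OF tendsto_const]
        filterlim_at_top_imp_at_infinity filterlim_ident)
  have "\<forall>\<^sub>F t in at_top. (\<Sum>I | card I = k. (\<Prod>i\<in>I. x $ i / t + v $ i) * (1 / t) ^ (m - k))
      = esym k (x + t *\<^sub>R v) / t ^ m"
    using eventually_gt_at_top[of 0]
  proof eventually_elim
    case (elim t)
    have "(\<Prod>i\<in>I. x $ i / t + v $ i) * (1 / t) ^ (m - k) = (\<Prod>i\<in>I. (x + t *\<^sub>R v) $ i) / t ^ m"
      if "card I = k" for I
    proof -
      have "(\<Prod>i\<in>I. x $ i / t + v $ i) = (\<Prod>i\<in>I. (x + t *\<^sub>R v) $ i / t)"
        using elim by (intro prod.cong) (auto simp: field_simps)
      also have "\<dots> = (\<Prod>i\<in>I. (x + t *\<^sub>R v) $ i) / t ^ k"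
        by (simp add: prod_dividef that)
      finally show ?thesis
        using k by (simp add: power_one_over flip: power_add)
    qed
    then show ?case
      by (simp add: esym_def sum_divide_distrib)
  qed
  then show ?thesis
    using Lim_transform_eventually[OF lim] k by (simp add: power_0_left)
qed

lemma upsilon_poly_growth:
  fixes x v :: "real ^ 'n"
  shows "((\<lambda>t. upsilon_poly c (x + t *\<^sub>R v) / t ^ CARD('n)) \<longlongrightarrow> (\<Prod>i\<in>UNIV. v $ i)) at_top"
proof -
  have lim: "((\<lambda>t. (\<Prod>i\<in>UNIV. x $ i / t + v $ i)
        - (\<Sum>k<CARD('n). c k * (esym k (x + t *\<^sub>R v) / t ^ CARD('n))))
      \<longlongrightarrow> (\<Prod>i\<in>UNIV. 0 + v $ i) - (\<Sum>k<CARD('n). c k * 0)) at_top"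
    by (intro tendsto_intros tendsto_divide_0[OF tendsto_const] esym_growth_lower
        filterlim_at_top_imp_at_infinity filterlim_ident) auto
  have "\<forall>\<^sub>F t in at_top. (\<Prod>i\<in>UNIV. x $ i / t + v $ i)
        - (\<Sum>k<CARD('n). c k * (esym k (x + t *\<^sub>R v) / t ^ CARD('n)))
      = upsilon_poly c (x + t *\<^sub>R v) / t ^ CARD('n)"
    using eventually_gt_at_top[of 0]
  proof eventually_elim
    case (elim t)
    have "(\<Prod>i\<in>UNIV. x $ i / t + v $ i) = (\<Prod>i\<in>UNIV. (x + t *\<^sub>R v) $ i / t)"
      using elim by (intro prod.cong) (auto simp: field_simps)
    also have "\<dots> = (\<Prod>i\<in>UNIV. (x + t *\<^sub>R v) $ i) / t ^ CARD('n)"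
      by (simp add: prod_dividef)
    finally show ?case
      by (simp add: upsilon_poly_def sum_divide_distrib diff_divide_distrib)
  qed
  then show ?thesis
    using Lim_transform_eventually[OF lim] by simp
qed

lemma upsilon_poly_permute:
  fixes x :: "real ^ 'n"
  assumes s: "s permutes UNIV"
  shows "upsilon_poly c (\<chi> i. x $ s i) = upsilon_poly c x"
proof -
  have inj: "inj s"
    using permutes_inj[OF s] .
  have "esym k (\<chi> i. x $ s i) = esym k x" for k
  proof -
    have "esym k x = (\<Sum>I | card I = k. \<Prod>i\<in>s ` I. x $ i)"
      unfolding esym_def
    proof (rule sum.reindex_bij_witness[of _ "(`) s" "(`) (inv s)"])
      fix I :: "'n set"
      assume "I \<in> {I. card I = k}"
      then show "inv s ` I \<in> {I. card I = k}"
        using permutes_inj[OF permutes_inv[OF s]]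
        by (simp add: card_image inj_on_subset[OF _ subset_UNIV])
    qed (use s inj in \<open>auto simp: image_image permutes_inverses card_image inj_on_subset\<close>)
    also have "\<dots> = esym k (\<chi> i. x $ s i)"
      unfolding esym_def
      by (intro sum.cong prod.reindex[THEN trans]) (auto intro: inj_on_subset[OF inj])
    finally show ?thesis ..
  qed
  moreover have "(\<Prod>i\<in>UNIV. x $ s i) = (\<Prod>i\<in>UNIV. x $ i)"
    using prod.permute[OF s, of "\<lambda>i. x $ i"] by (simp add: comp_def)
  ultimately show ?thesis
    by (simp add: upsilon_poly_def)
qed

lemma subset_translated_pos_cone_iff:
  "L \<subseteq> (+) q ` pos_cone \<longleftrightarrow> (\<forall>x\<in>L. \<forall>i. q $ i < x $ i)"
proof -
  have "x \<in> (+) q ` pos_cone \<longleftrightarrow> (\<forall>i. q $ i < x $ i)" for x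
    by (auto simp: pos_cone_def intro!: image_eqI[of _ _ "x - q"])
  then show ?thesis
    by blast
qed

text \<open>Permuting the coordinates is a homeomorphism that preserves \<open>A\<close>. Maximality of the image is shown by pulling
  a larger connected set back to \<open>L\<close>.\<close>

lemma component_image_permute:
  fixes s :: "'n::finite \<Rightarrow> 'n"
  defines "P \<equiv> \<lambda>s. \<lambda>x :: real ^ 'n. \<chi> i. x $ s i"
  assumes s: "s permutes UNIV" and L: "L \<in> components A"
    and A: "\<And>s. s permutes UNIV \<Longrightarrow> P s ` A \<subseteq> A"
  shows "P s ` L \<in> components A"
proof -
  have inv: "P s (P (inv s) x) = x" "P (inv s) (P s x) = x" for x
    using permutes_inverses[OF s] by (auto simp: P_def vec_eq_iff)
  have conn: "connected (P r ` B)" if "connected B" for r B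
    unfolding P_def by (intro connected_continuous_image continuous_intros that)
  show ?thesis
    unfolding in_components_maximal
  proof (intro conjI allI impI)
    show "P s ` L \<noteq> {}"
      using in_components_nonempty[OF L] by simp
    show "connected (P s ` L)"
      using conn in_components_connected[OF L] by blast
    show "P s ` L \<subseteq> A"
      using in_components_subset[OF L] A[OF s] by blast
    fix T
    assume T: "T \<noteq> {} \<and> P s ` L \<subseteq> T \<and> T \<subseteq> A \<and> connected T"
    have "L \<subseteq> P (inv s) ` T"
    proof
      fix x
      assume "x \<in> L"
      then have "P (inv s) (P s x) \<in> P (inv s) ` T"
        using T by blast
      then show "x \<in> P (inv s) ` T"
        by (simp only: inv)
    qed
    moreover have "P (inv s) ` T \<subseteq> A"
      using T A[OF permutes_inv[OF s]] by blast
    ultimately have "P (inv s) ` T \<subseteq> L"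
      using components_maximal[OF L conn[of T]] T in_components_nonempty[OF L] by blast
    then have "P s ` (P (inv s) ` T) \<subseteq> P s ` L"
      by blast
    then have "T \<subseteq> P s ` L"
      by (simp add: image_image inv)
    then show "T = P s ` L"
      using T by blast
  qed
qed

section \<open>The unique zero component and the region it bounds\<close>

theorem proposition2p9:
  fixes c :: "nat \<Rightarrow> real"
    and f :: "real ^ 'n::{finite,linorder} \<Rightarrow> real"
    and L :: "(real ^ 'n::{finite,linorder}) set"
  assumes n: "CARD('n) \<ge> 2"
    and f: "f = upsilon_poly c"
    and L: "L \<in> components {x. f x = 0}"
    and L_cone: "\<exists>q. L \<subseteq> (+) q ` pos_cone"
  shows "(\<forall>L'\<in>components {x. f x = 0}. (\<exists>q. L' \<subseteq> (+) q ` pos_cone) \<longrightarrow> L' = L) \<and>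
    (\<exists>!C. C \<in> components {x. f x > 0} \<and> strictly_upsilon_stable f C \<and> frontier C = L)"
proof -
  obtain q where q: "\<And>x i. x \<in> L \<Longrightarrow> q $ i < x $ i"
    using L_cone by (auto simp: subset_translated_pos_cone_iff)
  interpret affine_zero_component f L q
    unfolding f
    using continuous_upsilon_poly upsilon_poly_affine upsilon_poly_growth L[unfolded f] q
    by (rule affine_zero_component.intro)
  have unique: "L' = L" if "L' \<in> components {x. f x = 0}" "L' \<subseteq> (+) q' ` pos_cone" for L' q'
    using zero_component_unique[OF that(1)] that(2) by (auto simp: subset_translated_pos_cone_iff)
  define l :: 'n where "l = Max UNIV"
  have stable: "upsilon_stable f (above l)"
    unfolding upsilon_stable_def
  proof (intro conjI exI)
    show "above l \<in> components {x. f x > 0}"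
      by (rule above_component)
    show "above l \<subseteq> (+) q ` pos_cone"
      unfolding subset_translated_pos_cone_iff
    proof (intro ballI allI)
      fix x i
      assume "x \<in> above l"
      then obtain p t where "p \<in> L" "t > 0" "x = p + t *\<^sub>R axis l 1"
        by (auto simp: above_eq)
      then show "q $ i < x $ i"
        using q[of p i] by (auto simp: axis_def)
    qed
  qed
  have permute_L: "(\<chi> i. p $ s i) \<in> L" if p: "p \<in> L" and s: "s permutes UNIV" for p s
  proof -
    let ?P = "\<lambda>x :: (real, 'n) vec. \<chi> i. x $ s i"
    have "?P ` L \<in> components {x. f x = 0}"
    proof (rule component_image_permute[OF s L])
      show "(\<lambda>x. \<chi> i. x $ r i) ` {x. f x = 0} \<subseteq> {x. f x = 0}" if "r permutes UNIV" for r
        using upsilon_poly_permute[OF that, of c] by (simp add: f image_subset_iff)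
    qed
    moreover have "?P ` L \<subseteq> (+) (\<chi> i. q $ s i) ` pos_cone"
      using q by (auto simp: subset_translated_pos_cone_iff)
    ultimately have "?P ` L = L"
      by (rule unique)
    then show ?thesis
      using p by blast
  qed
  have "frontier (above l) \<subseteq> upsilon_1 (above l)"
    unfolding frontier_above upsilon_1_def
  proof (intro subsetI CollectI allI impI)
    fix p s
    assume p: "p \<in> L" and s: "s permutes (UNIV :: 'n set)"
    let ?p = "\<chi> i. p $ s i"
    \<comment> \<open>A step in the last direction leads into the region and does not change the projection.\<close>
    have "?p + 1 *\<^sub>R axis l 1 \<in> above l"
      unfolding above_eq by (rule image_eqI[where x = "(?p, 1)"]) (use permute_L[OF p s] in auto)
    moreover have "drop_last ?p = drop_last (?p + 1 *\<^sub>R axis l 1)"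
      unfolding drop_last_def by (rule restrict_ext) (simp add: l_def axis_def)
    ultimately show "drop_last ?p \<in> drop_last ` above l"
      by (intro image_eqI)
  qed
  then have "above l \<in> components {x. f x > 0} \<and> strictly_upsilon_stable f (above l)
      \<and> frontier (above l) = L"
    using stable above_component frontier_above by (simp add: strictly_upsilon_stable_def)
  then have "\<exists>!C. C \<in> components {x. f x > 0} \<and> strictly_upsilon_stable f C \<and> frontier C = L"
    by (rule ex1I) (simp add: component_with_frontier_L_unique)
  moreover have "\<forall>L'\<in>components {x. f x = 0}. (\<exists>q. L' \<subseteq> (+) q ` pos_cone) \<longrightarrow> L' = L"
    using unique by (intro ballI impI) (elim exE)
  ultimately show ?thesis
    by (rule conjI[rotated])
qed

end
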